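(* Let $(X_t)_{t\ge0}$ be a birth–death process on $\{0,1,\dots,n\}$ with birth rates $(\lambda_x)$, death rates $(\nu_x)$, and stationary distribution $\pi$. Assume that there exists $K>0$ such that $\min_{x\in\{1,\dots,n\}}(\lambda_{x-1}-\lambda_x+\nu_x-\nu_{x-1})\ge K$. If $f\in\mathrm{Lip}_d(\{0,1,\dots,n\})$, then for any $x\in\{0,1,\dots,n\}$, any $t>0$ and any $y>0$, $$\mathbb{P}_x\big(f(X_t)-\mathbb{E}_x[f(X_t)]\ge y\big)\le\exp\left(-\frac{y}{2\|f\|_{\mathrm{Lip}_d}}\log\left(1+\frac{2Ky}{(1-e^{-2Kt})\|\lambda+\nu\|_\infty\|f\|_{\mathrm{Lip}_d}}\right)\right).$$ In particular, under the stationary distribution $\pi$, for any $y>0$, $$\pi\big(f-\pi(f)\ge y\big)\le\exp\left(-\frac{y}{2\|f\|_{\mathrm{Lip}_d}}\log\left(1+\frac{2Ky}{\|\lambda+\nu\|_\infty\|f\|_{\mathrm{Lip}_d}}\right)\right).$$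
   Context: The state space $\{0,1,\dots,n\}$ carries the metric $d(x,y)=|x-y|$. The birth–death process is the continuous-time Markov chain with generator $\mathcal{L}f(x)=\lambda_x(f(x+1)-f(x))+\nu_x(f(x-1)-f(x))$, where the rates are positive except $\nu_0=0$ and $\lambda_n=0$. $\mathbb{P}_x,\mathbb{E}_x$ refer to the process started at $x$. $\|\lambda+\nu\|_\infty=\max_x(\lambda_x+\nu_x)$, $\|f\|_{\mathrm{Lip}_d}=\sup_{x\ne y}|f(x)-f(y)|/|x-y|$, $\mathrm{Lip}_d(\{0,1,\dots,n\})$ is the set of real functions with finite $\|f\|_{\mathrm{Lip}_d}$, and $\pi(f)=\sum_x f(x)\pi(x)$. *)

theory Defs
  imports "HOL-Probability.Probability"
begin

(* A time-homogeneous continuous-time Markov chain on a finite set S: P x is the law of the process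
   started at x and X t the position at time t (only t >= 0 is relevant).  No path regularity is
   required; only finite-dimensional distributions are constrained. *)
locale finite_ctmc =
  fixes S :: "'s set"
    and L :: "('s \<Rightarrow> real) \<Rightarrow> 's \<Rightarrow> real"
    and P :: "'s \<Rightarrow> 'w measure"
    and X :: "real \<Rightarrow> 'w \<Rightarrow> 's"
  assumes finite_states: "finite S"
    and prob_space_P: "x \<in> S \<Longrightarrow> prob_space (P x)"
    and sets_P: "x \<in> S \<Longrightarrow> y \<in> S \<Longrightarrow> sets (P x) = sets (P y)"
    and measurable_X: "x \<in> S \<Longrightarrow> t \<ge> 0 \<Longrightarrow> X t \<in> P x \<rightarrow>\<^sub>M count_space S"
    and start: "x \<in> S \<Longrightarrow> AE \<omega> in P x. X 0 \<omega> = x"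
      (* the past is described by the values a r at finitely many times r in J *)
    and markov: "x \<in> S \<Longrightarrow> 0 \<le> s \<Longrightarrow> 0 \<le> t \<Longrightarrow> finite J \<Longrightarrow> J \<subseteq> {0..s} \<Longrightarrow> u \<in> S \<Longrightarrow> v \<in> S \<Longrightarrow>
        \<P>(\<omega> in P x. (\<forall>r\<in>J. X r \<omega> = a r) \<and> X s \<omega> = u \<and> X (s + t) \<omega> = v) =
        \<P>(\<omega> in P x. (\<forall>r\<in>J. X r \<omega> = a r) \<and> X s \<omega> = u) * \<P>(\<omega> in P u. X t \<omega> = v)"
    and generator: "x \<in> S \<Longrightarrow>
        ((\<lambda>t. ((\<integral>\<omega>. g (X t \<omega>) \<partial>P x) - g x) / t) \<longlongrightarrow> L g x) (at_right 0)"

(* The values f (n + 1) and f (0 - 1) are irrelevant because birth n = 0 and death 0 = 0. *)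
definition bd_generator :: "(nat \<Rightarrow> real) \<Rightarrow> (nat \<Rightarrow> real) \<Rightarrow> (nat \<Rightarrow> real) \<Rightarrow> nat \<Rightarrow> real" where
  "bd_generator birth death f x =
     birth x * (f (x + 1) - f x) + death x * (f (x - 1) - f x)"

locale birth_death_process =
  finite_ctmc "{0..n}" "bd_generator birth death" P X
  for n :: nat and birth death :: "nat \<Rightarrow> real"
    and P :: "nat \<Rightarrow> 'w measure" and X :: "real \<Rightarrow> 'w \<Rightarrow> nat" +
  assumes birth_pos: "x < n \<Longrightarrow> birth x > 0"
    and birth_n: "birth n = 0"
    and death_pos: "0 < x \<Longrightarrow> x \<le> n \<Longrightarrow> death x > 0"
    and death_0: "death 0 = 0"

definition stationary_distribution ::
  "'s set \<Rightarrow> ('s \<Rightarrow> 'w measure) \<Rightarrow> (real \<Rightarrow> 'w \<Rightarrow> 's) \<Rightarrow> 's pmf \<Rightarrow> bool" where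
  "stationary_distribution S P X \<pi> \<longleftrightarrow> set_pmf \<pi> \<subseteq> S \<and>
     (\<forall>t\<ge>0. \<forall>y\<in>S. (\<Sum>x\<in>S. pmf \<pi> x * \<P>(\<omega> in P x. X t \<omega> = y)) = pmf \<pi> y)"

definition lip_quotients :: "nat set \<Rightarrow> (nat \<Rightarrow> real) \<Rightarrow> real set" where
  "lip_quotients S f = {\<bar>f x - f y\<bar> / \<bar>real x - real y\<bar> | x y. x \<in> S \<and> y \<in> S \<and> x \<noteq> y}"

(* The supremum is taken among nonnegative reals: inserting 0 only matters if S has at most one
   point. *)
definition lip_norm :: "nat set \<Rightarrow> (nat \<Rightarrow> real) \<Rightarrow> real" where
  "lip_norm S f = Sup (insert 0 (lip_quotients S f))"

definition Lip :: "nat set \<Rightarrow> (nat \<Rightarrow> real) set" where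
  "Lip S = {f. bdd_above (lip_quotients S f)}"

definition rate_norm :: "nat \<Rightarrow> (nat \<Rightarrow> real) \<Rightarrow> (nat \<Rightarrow> real) \<Rightarrow> real" where
  "rate_norm n birth death = (MAX x\<in>{0..n}. birth x + death x)"

end

theory Submission
  imports Defs
begin

text \<open>
  Write \<open>P\<^sub>t\<close> for the transition semigroup and \<open>\<Lambda> = max (\<lambda> + \<nu>)\<close>.  The curvature condition
  makes \<open>I + h L\<close> contract Lipschitz constants by \<open>1 - h K\<close> for small \<open>h\<close>, so
  \<open>P\<^sub>t f\<close> is \<open>exp (-K t)\<close>-Lipschitz when \<open>f\<close> is 1-Lipschitz.  As the process jumps
  to neighbours only, a \<open>b\<close>-Lipschitz \<open>g\<close> satisfies
  \<open>P\<^sub>h (exp g) \<le> exp (P\<^sub>h g + h \<Lambda> (exp b - 1 - b) + o(h))\<close>.  Iterating this along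
  \<open>g = P\<^sub>k\<^sub>h f\<close> and using \<open>exp (b c) - 1 - b c \<le> c\<^sup>2 (exp b - 1 - b)\<close> with
  \<open>c = exp (-K k h)\<close> leaves a geometric sum tending to \<open>(1 - exp (-2 K t)) / (2 K)\<close>;
  Chernoff's bound finishes the argument.  Letting \<open>t \<rightarrow> \<infinity>\<close> in the Laplace transform
  bound, where \<open>P\<^sub>t f\<close> flattens to \<open>\<pi>(f)\<close>, gives the stationary case.
  Only the off-diagonal small-time behaviour of the transition probabilities enters;
  \<open>P\<^sub>t\<close> is never differentiated at positive times.
\<close>

section \<open>The exponential remainder and Chernoff's bound\<close>

text \<open>This is the logarithm of the Laplace transform of a centred Poisson variable of mean 1,
  the source of the Bennett-type exponent.\<close>

definition exp_rem :: "real \<Rightarrow> real" where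
  "exp_rem z = exp z - 1 - z"

lemma exp_rem_sums: "(\<lambda>k. z ^ (k + 2) / fact (k + 2)) sums exp_rem z"
proof -
  have "(\<lambda>k. z ^ k / fact k) sums exp z"
    using exp_converges[of z] by (simp add: field_simps scaleR_conv_of_real)
  from sums_split_initial_segment[OF this, of 2] show ?thesis
    by (simp add: exp_rem_def numeral_2_eq_2 algebra_simps)
qed

lemma exp_rem_nonneg: "0 \<le> exp_rem z"
  using exp_ge_add_one_self[of z] by (simp add: exp_rem_def del: exp_ge_add_one_self)

text \<open>The power series of \<open>exp_rem\<close> starts at degree 2, so each coefficient
  comparison gains a factor \<open>c ^ (k + 2)\<close>, of which only the square is kept because
  \<open>c \<le> 1\<close>. This quadratic gain makes the contraction rate enter as
  \<open>2 * K\<close>.\<close>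

lemma exp_rem_le_scaled:
  assumes "\<bar>z\<bar> \<le> c * b" "0 \<le> c" "c \<le> 1" "0 \<le> b"
  shows "exp_rem z \<le> c\<^sup>2 * exp_rem b"
proof (rule sums_le[OF _ exp_rem_sums sums_mult[OF exp_rem_sums]])
  fix k
  have "z ^ (k + 2) \<le> \<bar>z\<bar> ^ (k + 2)"
    by (metis abs_ge_self power_abs)
  also have "\<dots> \<le> (c * b) ^ (k + 2)"
    using assms by (intro power_mono) auto
  also have "\<dots> = c\<^sup>2 * (c ^ k * b ^ (k + 2))"
    by (simp add: power_mult_distrib power_add power2_eq_square)
  also have "\<dots> \<le> c\<^sup>2 * (1 * b ^ (k + 2))"
    using assms by (intro mult_left_mono mult_right_mono power_le_one) auto
  finally show "z ^ (k + 2) / fact (k + 2) \<le> c\<^sup>2 * (b ^ (k + 2) / fact (k + 2))"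
    by (simp add: divide_right_mono)
qed

lemma exp_rem_mono: "\<bar>z\<bar> \<le> b \<Longrightarrow> exp_rem z \<le> exp_rem b"
  using exp_rem_le_scaled[of z 1 b] by auto

text \<open>Weakens Bennett's exponent to the logarithmic form of the theorem. The difference of the
  two sides vanishes at 0 and is monotone, because \<open>ln (1 + v)\<close> is at least
  \<open>v / (1 + v)\<close>.\<close>

lemma bennett_half_bound:
  fixes u :: real
  assumes "0 \<le> u"
  shows "u - (1 + u) * ln (1 + u) \<le> - (u / 2) * ln (1 + u)"
proof -
  define h where "h v = (1 + v / 2) * ln (1 + v) - v" for v :: real
  have "h 0 \<le> h u"
  proof (rule DERIV_nonneg_imp_nondecreasing[OF assms])
    fix v :: real assume v: "0 \<le> v" "v \<le> u"
    have "(h has_real_derivative (ln (1 + v) / 2 + (1 + v / 2) / (1 + v) - 1)) (at v)"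
      unfolding h_def using v by (auto intro!: derivative_eq_intros)
    moreover have "1 - 1 / (1 + v) \<le> ln (1 + v)"
      using ln_le_minus_one[of "1 / (1 + v)"] v by (simp add: ln_div)
    then have "0 \<le> ln (1 + v) / 2 + (1 + v / 2) / (1 + v) - 1"
      using v by (simp add: field_simps)
    ultimately show "\<exists>d. (h has_real_derivative d) (at v) \<and> 0 \<le> d" by blast
  qed
  then show ?thesis by (simp add: h_def algebra_simps)
qed

text \<open>The choice \<open>a = ln (1 + y / (C M)) / M\<close> optimises the exponent.\<close>
lemma chernoff_exp_rem:
  fixes w g :: "'a \<Rightarrow> real"
  assumes "finite S" and w: "\<And>x. x \<in> S \<Longrightarrow> 0 \<le> w x"
    and pos: "0 < C" "0 < M" "0 < y"
    and laplace: "\<And>a. 0 < a \<Longrightarrow> (\<Sum>x\<in>S. w x * exp (a * g x)) \<le> exp (a * m + C * exp_rem (a * M))"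
  shows "(\<Sum>x\<in>{x\<in>S. g x - m \<ge> y}. w x) \<le> exp (- (y / (2 * M)) * ln (1 + y / (C * M)))"
proof -
  define u where "u = y / (C * M)"
  define a where "a = ln (1 + u) / M"
  have u: "0 < u" using pos by (simp add: u_def)
  have a: "0 < a" using u pos by (simp add: a_def)
  have aM: "a * M = ln (1 + u)" using pos by (simp add: a_def)
  \<comment> \<open>Markov's inequality for the weights \<open>w\<close>: on the tail set the
    inserted exponential factor is at least 1.\<close>
  have "(\<Sum>x\<in>{x\<in>S. g x - m \<ge> y}. w x)
      \<le> (\<Sum>x\<in>{x\<in>S. g x - m \<ge> y}. w x * exp (a * g x) * exp (- a * (m + y)))"
  proof (rule sum_mono)
    fix x assume x: "x \<in> {x\<in>S. g x - m \<ge> y}"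
    have "0 \<le> a * (g x - m - y)" using x a by simp
    then have "1 \<le> exp (a * g x) * exp (- a * (m + y))"
      by (simp add: exp_add[symmetric] algebra_simps)
    from mult_left_mono[OF this, of "w x"] w[of x] x
    show "w x \<le> w x * exp (a * g x) * exp (- a * (m + y))" by (simp add: mult.assoc)
  qed
  also have "\<dots> \<le> (\<Sum>x\<in>S. w x * exp (a * g x) * exp (- a * (m + y)))"
    using \<open>finite S\<close> w by (intro sum_mono2) auto
  also have "\<dots> = (\<Sum>x\<in>S. w x * exp (a * g x)) * exp (- a * (m + y))"
    by (simp add: sum_distrib_right)
  also have "\<dots> \<le> exp (a * m + C * exp_rem (a * M)) * exp (- a * (m + y))"
    using laplace[OF a] by (intro mult_right_mono) auto
  also have "\<dots> = exp (C * exp_rem (a * M) - a * y)"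
    by (simp add: exp_add[symmetric] algebra_simps)
  also have "C * exp_rem (a * M) - a * y = C * (u - (1 + u) * ln (1 + u))"
  proof -
    have "a * y = C * u * ln (1 + u)" using pos by (simp add: a_def u_def)
    then show ?thesis using u unfolding aM exp_rem_def by (simp add: algebra_simps)
  qed
  also have "\<dots> \<le> C * (- (u / 2) * ln (1 + u))"
    using bennett_half_bound[of u] u pos by (intro mult_left_mono) auto
  also have "\<dots> = - (y / (2 * M)) * ln (1 + y / (C * M))"
    using pos by (simp add: u_def)
  finally show ?thesis by simp
qed

section \<open>Lipschitz functions on an interval of integers\<close>

text \<open>The constant is a parameter, so that it can be tracked through iterations without
  computing a supremum. If \<open>S\<close> has at most one point, the inequalities leave the sign
  of \<open>b\<close> open, hence the separate clause.\<close>

definition nat_lipschitz :: "real \<Rightarrow> nat set \<Rightarrow> (nat \<Rightarrow> real) \<Rightarrow> bool" where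
  "nat_lipschitz b S g \<longleftrightarrow>
     0 \<le> b \<and> (\<forall>x\<in>S. \<forall>y\<in>S. \<bar>g x - g y\<bar> \<le> b * \<bar>real x - real y\<bar>)"

lemma nat_lipschitzI:
  assumes "0 \<le> b" "\<And>x y. x \<in> S \<Longrightarrow> y \<in> S \<Longrightarrow> \<bar>g x - g y\<bar> \<le> b * \<bar>real x - real y\<bar>"
  shows "nat_lipschitz b S g"
  using assms by (simp add: nat_lipschitz_def)

lemma nat_lipschitzD:
  "nat_lipschitz b S g \<Longrightarrow> x \<in> S \<Longrightarrow> y \<in> S \<Longrightarrow> \<bar>g x - g y\<bar> \<le> b * \<bar>real x - real y\<bar>"
  by (simp add: nat_lipschitz_def)

lemma nat_lipschitz_nonneg: "nat_lipschitz b S g \<Longrightarrow> 0 \<le> b"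
  by (simp add: nat_lipschitz_def)

lemma nat_lipschitz_cong:
  "nat_lipschitz b S g \<Longrightarrow> (\<And>x. x \<in> S \<Longrightarrow> g x = h x) \<Longrightarrow> nat_lipschitz b S h"
  by (simp add: nat_lipschitz_def)

lemma nat_lipschitz_cmult:
  assumes "nat_lipschitz b S g" "0 \<le> a"
  shows "nat_lipschitz (a * b) S (\<lambda>x. a * g x)"
  using assms
  by (auto simp: nat_lipschitz_def abs_mult mult.assoc mult_left_mono simp flip: right_diff_distrib)

text \<open>Increments between neighbours telescope along the interval, so contraction only has to
  be checked for \<open>x\<close> and \<open>Suc x\<close>.\<close>

lemma nat_lipschitz_interval:
  fixes g :: "nat \<Rightarrow> real"
  assumes "0 \<le> b" and step: "\<And>x. x < n \<Longrightarrow> \<bar>g (Suc x) - g x\<bar> \<le> b"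
  shows "nat_lipschitz b {0..n} g"
proof -
  have up: "\<bar>g (x + k) - g x\<bar> \<le> b * real k" if "x + k \<le> n" for x k
    using that
  proof (induction k)
    case (Suc k)
    then show ?case using step[of "x + k"] by (simp add: algebra_simps)
  qed simp
  show ?thesis
  proof (rule nat_lipschitzI[OF \<open>0 \<le> b\<close>])
    fix x y assume "x \<in> {0..n}" "y \<in> {0..n}"
    then show "\<bar>g x - g y\<bar> \<le> b * \<bar>real x - real y\<bar>"
      using up[of x "y - x"] up[of y "x - y"]
      by (cases "x \<le> y") (auto simp: dist_real_def of_nat_diff abs_minus_commute)
  qed
qed

lemma nat_lipschitz_diff:
  fixes g :: "nat \<Rightarrow> real"
  assumes "nat_lipschitz b {0..n} g" "x \<le> n" "y \<le> n"
  shows "\<bar>g y - g x\<bar> \<le> real n * b"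
proof -
  have "\<bar>g y - g x\<bar> \<le> b * \<bar>real y - real x\<bar>"
    using nat_lipschitzD[OF assms(1), of y x] assms by simp
  also have "\<dots> \<le> b * real n"
    using assms nat_lipschitz_nonneg[OF assms(1)]
    by (intro mult_left_mono) (auto simp:)
  finally show ?thesis by (simp add: mult.commute)
qed

lemma nat_lipschitz_step:
  fixes g :: "nat \<Rightarrow> real"
  assumes "nat_lipschitz b {0..n} g" "x < n"
  shows "\<bar>g (Suc x) - g x\<bar> \<le> b"
  using nat_lipschitzD[OF assms(1), of "Suc x" x] assms by simp

lemma nat_lipschitz_lip_norm:
  assumes "f \<in> Lip S"
  shows "nat_lipschitz (lip_norm S f) S f"
proof (rule nat_lipschitzI)
  have bdd: "bdd_above (insert 0 (lip_quotients S f))"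
    using assms by (simp add: Lip_def)
  show "0 \<le> lip_norm S f"
    unfolding lip_norm_def by (intro cSup_upper bdd) auto
  fix x y assume xy: "x \<in> S" "y \<in> S"
  show "\<bar>f x - f y\<bar> \<le> lip_norm S f * \<bar>real x - real y\<bar>"
  proof (cases "x = y")
    case False
    have "\<bar>f x - f y\<bar> / \<bar>real x - real y\<bar> \<le> lip_norm S f"
      unfolding lip_norm_def using xy False
      by (intro cSup_upper bdd) (auto simp: lip_quotients_def)
    then show ?thesis
      using False by (simp add: field_simps)
  qed simp
qed

text \<open>Cuts the time \<open>t\<close> into \<open>m\<close> equal steps shorter than a
  prescribed threshold. Since division by 0 gives 0, the first conclusion also excludes
  \<open>m = 0\<close>.\<close>

lemma nat_fraction_less:
  fixes \<epsilon> t :: real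
  assumes "0 < \<epsilon>" "0 < t"
  obtains m :: nat where "0 < t / real m" "t / real m < \<epsilon>" "t = real m * (t / real m)"
proof -
  obtain m :: nat where m: "t / \<epsilon> < real m" using reals_Archimedean2 by blast
  moreover have "0 < t / \<epsilon>" using assms by simp
  ultimately have "0 < real m" by linarith
  then show thesis using m assms by (intro that[of m]) (auto simp: field_simps)
qed

section \<open>The transition semigroup of a finite chain and its small-time behaviour\<close>

context finite_ctmc
begin

definition transition :: "real \<Rightarrow> 's \<Rightarrow> 's \<Rightarrow> real" where
  "transition t x y = \<P>(\<omega> in P x. X t \<omega> = y)"

text \<open>A finite sum instead of an integral: linearity and monotonicity then require no
  integrability. \<open>integral_eq_semi\<close> identifies it with the expectation under
  \<open>P x\<close>.\<close>

definition semi :: "real \<Rightarrow> ('s \<Rightarrow> real) \<Rightarrow> 's \<Rightarrow> real" where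
  "semi t g x = (\<Sum>y\<in>S. transition t x y * g y)"

lemma X_in_S: "x \<in> S \<Longrightarrow> 0 \<le> t \<Longrightarrow> \<omega> \<in> space (P x) \<Longrightarrow> X t \<omega> \<in> S"
  using measurable_space[OF measurable_X] by fastforce

lemma sets_X_eq:
  assumes "x \<in> S" "0 \<le> t"
  shows "{\<omega> \<in> space (P x). Q (X t \<omega>)} \<in> sets (P x)"
proof -
  have "{\<omega> \<in> space (P x). Q (X t \<omega>)} = X t -` {y\<in>S. Q y} \<inter> space (P x)"
    using X_in_S[OF assms] by auto
  also have "\<dots> \<in> sets (P x)"
    by (rule measurable_sets[OF measurable_X[OF assms]]) auto
  finally show ?thesis .
qed

lemma transition_nonneg: "0 \<le> transition t x y"
  by (simp add: transition_def)

lemma integral_eq_semi: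
  assumes "x \<in> S" "0 \<le> t"
  shows "(\<integral>\<omega>. g (X t \<omega>) \<partial>P x) = semi t g x"
proof -
  interpret prob_space "P x" using prob_space_P[OF \<open>x \<in> S\<close>] .
  let ?A = "\<lambda>y. {\<omega> \<in> space (P x). X t \<omega> = y}"
  have "(\<integral>\<omega>. g (X t \<omega>) \<partial>P x) = (\<integral>\<omega>. (\<Sum>y\<in>S. g y * indicator (?A y) \<omega>) \<partial>P x)"
  proof (rule Bochner_Integration.integral_cong[OF refl])
    fix \<omega> assume \<omega>: "\<omega> \<in> space (P x)"
    then show "g (X t \<omega>) = (\<Sum>y\<in>S. g y * indicator (?A y) \<omega>)"
      using X_in_S[OF assms \<omega>] finite_states
      by (simp add: indicator_def if_distrib sum.delta' cong: if_cong)
  qed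
  also have "\<dots> = (\<Sum>y\<in>S. g y * measure (P x) (?A y))"
    using sets_X_eq[OF assms] by (subst Bochner_Integration.integral_sum) (auto simp: less_top[symmetric])
  finally show ?thesis by (simp add: semi_def transition_def mult.commute)
qed

lemma semi_const: "x \<in> S \<Longrightarrow> 0 \<le> t \<Longrightarrow> semi t (\<lambda>_. c) x = c"
  using integral_eq_semi[of x t "\<lambda>_. c"] prob_space.prob_space[OF prob_space_P, of x] by simp

lemma sum_transition: "x \<in> S \<Longrightarrow> 0 \<le> t \<Longrightarrow> (\<Sum>y\<in>S. transition t x y) = 1"
  using semi_const[of x t 1] by (simp add: semi_def)

lemma semi_cmult: "semi t (\<lambda>y. c * g y) x = c * semi t g x"
  by (simp add: semi_def sum_distrib_left mult_ac)

lemma semi_mono: "(\<And>y. y \<in> S \<Longrightarrow> g y \<le> h y) \<Longrightarrow> semi t g x \<le> semi t h x"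
  unfolding semi_def by (intro sum_mono mult_left_mono transition_nonneg)

lemma prob_eq_sum_transition:
  assumes "x \<in> S" "0 \<le> t"
  shows "\<P>(\<omega> in P x. Q (X t \<omega>)) = (\<Sum>y\<in>{y\<in>S. Q y}. transition t x y)"
proof -
  interpret prob_space "P x" using prob_space_P[OF \<open>x \<in> S\<close>] .
  have "\<P>(\<omega> in P x. Q (X t \<omega>)) = (\<integral>\<omega>. indicator {y. Q y} (X t \<omega>) \<partial>P x)"
    using sets_X_eq[OF assms]
    by (subst Bochner_Integration.integral_cong[OF refl,
          of _ _ "indicator {\<omega> \<in> space (P x). Q (X t \<omega>)} :: _ \<Rightarrow> real"])
       (auto simp: indicator_def)
  also have "\<dots> = (\<Sum>y\<in>S. if Q y then transition t x y else 0)"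
    unfolding integral_eq_semi[OF assms] semi_def by (intro sum.cong) auto
  also have "\<dots> = (\<Sum>y\<in>{y\<in>S. Q y}. transition t x y)"
    using finite_states by (simp add: sum.inter_filter)
  finally show ?thesis .
qed

lemma chapman_kolmogorov:
  assumes "x \<in> S" "y \<in> S" "0 \<le> s" "0 \<le> t"
  shows "transition (s + t) x y = (\<Sum>z\<in>S. transition s x z * transition t z y)"
proof -
  interpret prob_space "P x" using prob_space_P[OF \<open>x \<in> S\<close>] .
  let ?A = "\<lambda>z. {\<omega> \<in> space (P x). X s \<omega> = z \<and> X (s + t) \<omega> = y}"
  have sets: "?A z \<in> sets (P x)" for z
    using sets.Int[OF sets_X_eq[of x s "\<lambda>u. u = z"] sets_X_eq[of x "s + t" "\<lambda>u. u = y"]] assms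
    by (auto simp: Int_def conj_ac elim!: back_subst[where P = "\<lambda>A. A \<in> sets (P x)"])
  have "{\<omega> \<in> space (P x). X (s + t) \<omega> = y} = (\<Union>z\<in>S. ?A z)"
    using X_in_S[of x s] assms by auto
  then have "transition (s + t) x y = measure (P x) (\<Union>z\<in>S. ?A z)"
    by (simp add: transition_def)
  also have "\<dots> = (\<Sum>z\<in>S. measure (P x) (?A z))"
    using finite_states sets by (intro finite_measure_finite_Union) (auto simp: disjoint_family_on_def)
  also have "\<dots> = (\<Sum>z\<in>S. transition s x z * transition t z y)"
    \<comment> \<open>With an empty past \<open>J\<close>, the Markov property is the two-time
      factorisation.\<close>
    using markov[of x s t "{}" _ y] assms by (intro sum.cong) (auto simp: transition_def)
  finally show ?thesis .
qed

lemma semi_add: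
  assumes "x \<in> S" "0 \<le> s" "0 \<le> t"
  shows "semi (s + t) g x = semi s (semi t g) x"
proof -
  have "semi (s + t) g x = (\<Sum>y\<in>S. \<Sum>z\<in>S. transition s x z * transition t z y * g y)"
    unfolding semi_def using assms
    by (intro sum.cong refl) (simp add: chapman_kolmogorov sum_distrib_right)
  also have "\<dots> = (\<Sum>z\<in>S. \<Sum>y\<in>S. transition s x z * transition t z y * g y)"
    by (rule sum.swap)
  finally show ?thesis by (simp add: semi_def sum_distrib_left mult_ac)
qed

lemma semi_0:
  assumes "x \<in> S"
  shows "semi 0 g x = g x"
proof -
  interpret prob_space "P x" using prob_space_P[OF \<open>x \<in> S\<close>] .
  have "(\<integral>\<omega>. g (X 0 \<omega>) \<partial>P x) = (\<integral>\<omega>. g x \<partial>P x)"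
  proof (rule integral_cong_AE)
    show "(\<lambda>\<omega>. g (X 0 \<omega>)) \<in> borel_measurable (P x)"
      using measurable_compose[OF measurable_X[OF assms, of 0], of g borel] by simp
    show "AE \<omega> in P x. g (X 0 \<omega>) = g x" using start[OF assms] by eventually_elim simp
  qed simp
  then show ?thesis using integral_eq_semi[OF assms, of 0 g] prob_space by simp
qed

lemma semi_increment:
  assumes "x \<in> S" "0 \<le> t"
  shows "semi t g x - c = (\<Sum>y\<in>S. transition t x y * (g y - c))"
  using sum_transition[OF assms]
  by (simp add: semi_def right_diff_distrib sum_subtractf flip: sum_distrib_right)

text \<open>The generator is applied to the indicator of \<open>{y}\<close>, which vanishes at the
  starting point \<open>x \<noteq> y\<close>, so its difference quotient is
  \<open>transition h x y / h\<close>. Finiteness of \<open>S\<close> makes the threshold uniform in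
  both states.\<close>

lemma transition_small_time:
  assumes "0 < \<epsilon>"
  obtains h\<^sub>0 where "0 < h\<^sub>0"
    "\<And>h x y. 0 < h \<Longrightarrow> h < h\<^sub>0 \<Longrightarrow> x \<in> S \<Longrightarrow> y \<in> S \<Longrightarrow> x \<noteq> y \<Longrightarrow>
       \<bar>transition h x y - h * L (indicator {y}) x\<bar> \<le> \<epsilon> * h"
proof -
  have "\<forall>\<^sub>F h in at_right 0. \<forall>x\<in>S. \<forall>y\<in>S. x \<noteq> y \<longrightarrow>
      \<bar>transition h x y - h * L (indicator {y}) x\<bar> \<le> \<epsilon> * h"
    unfolding eventually_ball_finite_distrib[OF finite_states]
  proof (intro ballI)
    fix x y assume xy: "x \<in> S" "y \<in> S"
    show "\<forall>\<^sub>F h in at_right 0. x \<noteq> y \<longrightarrow> \<bar>transition h x y - h * L (indicator {y}) x\<bar> \<le> \<epsilon> * h"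
    proof (cases "x = y")
      case False
      have "\<forall>\<^sub>F h in at_right 0.
          dist (((\<integral>\<omega>. indicator {y} (X h \<omega>) \<partial>P x) - indicator {y} x) / h) (L (indicator {y}) x) < \<epsilon>"
        using generator[OF xy(1), of "indicator {y}"] assms by (rule tendstoD)
      then show ?thesis using eventually_at_right_less[of 0]
      proof eventually_elim
        case (elim h)
        have "(\<integral>\<omega>. indicator {y} (X h \<omega>) \<partial>P x) = transition h x y"
          using elim xy finite_states integral_eq_semi[of x h "indicator {y}"]
          by (simp add: semi_def indicator_def if_distrib sum.delta' cong: if_cong)
        then have "\<bar>transition h x y / h - L (indicator {y}) x\<bar> < \<epsilon>"
          using elim False by (simp add: dist_real_def)
        moreover have "transition h x y - h * L (indicator {y}) x
            = h * (transition h x y / h - L (indicator {y}) x)"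
          using elim by (simp add: field_simps)
        ultimately show ?case using elim by (simp add: abs_mult mult.commute)
      qed
    qed simp
  qed
  then show thesis using that unfolding eventually_at_right_field by auto
qed

end

section \<open>Small-time expansions for the birth-death process\<close>

context birth_death_process
begin

abbreviation jump_rate :: "nat \<Rightarrow> nat \<Rightarrow> real" where
  "jump_rate x y \<equiv> bd_generator birth death (indicator {y}) x"

lemma rates_nonneg: "x \<le> n \<Longrightarrow> 0 \<le> birth x" "x \<le> n \<Longrightarrow> 0 \<le> death x"
  using birth_pos[of x] birth_n death_pos[of x] death_0
  by (cases "x = n"; simp; fail | cases "x = 0"; simp)+

lemma rates_le_rate_norm: "x \<le> n \<Longrightarrow> birth x + death x \<le> rate_norm n birth death"
  unfolding rate_norm_def by (intro Max_ge) auto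

text \<open>The condition \<open>g x = 0\<close> removes the diagonal rate, and at
  \<open>x = 0\<close> also the truncated predecessor \<open>0 - 1 = 0\<close>. At
  \<open>x = n\<close> the value \<open>g (n + 1)\<close> lies outside the state space, but its
  coefficient \<open>birth n\<close> is 0.\<close>

lemma sum_jump_rate:
  assumes "x \<le> n" "g x = 0"
  shows "(\<Sum>y\<in>{0..n}. jump_rate x y * g y) = birth x * g (x + 1) + death x * g (x - 1)"
proof -
  have "(\<Sum>y\<in>{0..n}. jump_rate x y * g y)
     = (\<Sum>y\<in>{0..n}. (if y = x + 1 then birth x * g y else 0) + (if y = x - 1 then death x * g y else 0))"
    using assms(2)
    by (intro sum.cong) (auto simp: bd_generator_def indicator_def)
  also have "\<dots> = (if x < n then birth x * g (x + 1) else 0) + death x * g (x - 1)"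
    using assms by (auto simp: sum.distrib sum.delta')
  finally show ?thesis using assms birth_n by (cases "x = n") auto
qed

text \<open>A function vanishing at \<open>x\<close> sees only the off-diagonal transition
  probabilities. The error is linear in the bound \<open>B\<close> and the threshold is independent
  of \<open>g\<close>, which allows one step size for a whole iteration.\<close>

lemma semi_small_time:
  assumes "0 < \<epsilon>"
  obtains h\<^sub>0 where "0 < h\<^sub>0"
    "\<And>h x (g :: nat \<Rightarrow> real) B. 0 < h \<Longrightarrow> h < h\<^sub>0 \<Longrightarrow> x \<le> n \<Longrightarrow> g x = 0 \<Longrightarrow> (\<And>y. y \<le> n \<Longrightarrow> \<bar>g y\<bar> \<le> B) \<Longrightarrow>
       \<bar>semi h g x - h * (birth x * g (x + 1) + death x * g (x - 1))\<bar> \<le> \<epsilon> * h * B"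
proof -
  \<comment> \<open>Each of the \<open>n + 1\<close> summands receives an equal share of the
    error.\<close>
  define \<delta> where "\<delta> = \<epsilon> / real (n + 1)"
  have \<delta>: "0 < \<delta>" using assms by (simp add: \<delta>_def)
  obtain h\<^sub>0 where h0: "0 < h\<^sub>0"
    "\<And>h x y. 0 < h \<Longrightarrow> h < h\<^sub>0 \<Longrightarrow> x \<in> {0..n} \<Longrightarrow> y \<in> {0..n} \<Longrightarrow> x \<noteq> y \<Longrightarrow>
       \<bar>transition h x y - h * jump_rate x y\<bar> \<le> \<delta> * h"
    using transition_small_time[OF \<delta>] by metis
  show thesis
  proof (rule that[OF h0(1)])
    fix h x B and g :: "nat \<Rightarrow> real"
    assume h: "0 < h" "h < h\<^sub>0" and x: "x \<le> n" "g x = 0" and B: "\<And>y. y \<le> n \<Longrightarrow> \<bar>g y\<bar> \<le> B"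
    have "semi h g x - h * (birth x * g (x + 1) + death x * g (x - 1))
        = (\<Sum>y\<in>{0..n}. (transition h x y - h * jump_rate x y) * g y)"
      unfolding sum_jump_rate[where g = g, OF x, symmetric]
      by (simp add: semi_def left_diff_distrib sum_subtractf sum_distrib_left mult.assoc)
    also have "\<bar>\<dots>\<bar> \<le> (\<Sum>y\<in>{0..n}. \<delta> * h * B)"
    proof (rule order_trans[OF sum_abs sum_mono])
      fix y assume y: "y \<in> {0..n}"
      have B0: "0 \<le> B" using B[OF x(1)] by linarith
      show "\<bar>(transition h x y - h * jump_rate x y) * g y\<bar> \<le> \<delta> * h * B"
      proof (cases "x = y")
        case True
        then show ?thesis using x h \<delta> B0 by simp
      next
        case False
        show ?thesis unfolding abs_mult
          using h0(2)[OF h, of x y] False x y B[of y] h \<delta>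
          by (intro mult_mono) auto
      qed
    qed
    also have "\<dots> = \<epsilon> * h * B" by (simp add: \<delta>_def field_simps)
    finally show "\<bar>semi h g x - h * (birth x * g (x + 1) + death x * g (x - 1))\<bar> \<le> \<epsilon> * h * B" .
  qed
qed

text \<open>Expand \<open>exp (g y - g x)\<close> as \<open>1 + (g y - g x)\<close> plus its
  \<open>exp_rem\<close>. The affine part averages exactly to \<open>1 + (semi h g x - g x)\<close>;
  the remainder vanishes at \<open>x\<close>, so to first order only jumps to neighbours count, each
  costing at most \<open>exp_rem b\<close>. Finally \<open>1 + z \<le> exp z\<close>.\<close>

lemma laplace_step:
  assumes "0 < \<epsilon>" "0 \<le> a"
  obtains h\<^sub>0 where "0 < h\<^sub>0"
    "\<And>h b g x. 0 < h \<Longrightarrow> h < h\<^sub>0 \<Longrightarrow> b \<le> a \<Longrightarrow> nat_lipschitz b {0..n} g \<Longrightarrow> x \<le> n \<Longrightarrow>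
       semi h (\<lambda>y. exp (g y)) x
         \<le> exp (semi h g x + h * (rate_norm n birth death * exp_rem b + \<epsilon>))"
proof -
  \<comment> \<open>Any admissible \<open>g\<close> oscillates by at most \<open>real n * a\<close>,
    so \<open>B\<close> bounds all remainders at once; the added 1 keeps
    \<open>\<epsilon> / B\<close> meaningful when \<open>exp_rem (real n * a)\<close> is 0.\<close>
  define B where "B = exp_rem (real n * a) + 1"
  have B: "0 < B" using exp_rem_nonneg[of "real n * a"] by (simp add: B_def)
  have "0 < \<epsilon> / B" using assms B by simp
  from semi_small_time[OF this] obtain h\<^sub>0 where h0: "0 < h\<^sub>0"
    "\<And>h x (g :: nat \<Rightarrow> real) C. 0 < h \<Longrightarrow> h < h\<^sub>0 \<Longrightarrow> x \<le> n \<Longrightarrow> g x = 0 \<Longrightarrow> (\<And>y. y \<le> n \<Longrightarrow> \<bar>g y\<bar> \<le> C) \<Longrightarrow>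
       \<bar>semi h g x - h * (birth x * g (x + 1) + death x * g (x - 1))\<bar> \<le> \<epsilon> / B * h * C"
    by metis
  show thesis
  proof (rule that[OF h0(1)])
    fix h b g x
    assume h: "0 < h" "h < h\<^sub>0" and b: "b \<le> a" and g: "nat_lipschitz b {0..n} g" and x: "x \<le> n"
    define r where "r y = exp_rem (g y - g x)" for y
    have b0: "0 \<le> b" using nat_lipschitz_nonneg[OF g] .
    have rB: "\<bar>r y\<bar> \<le> B" if "y \<le> n" for y
    proof -
      have "\<bar>g y - g x\<bar> \<le> real n * b" using nat_lipschitz_diff[OF g x that] .
      also have "\<dots> \<le> real n * a" using b by (intro mult_left_mono) auto
      finally show ?thesis
        using exp_rem_mono exp_rem_nonneg[of "g y - g x"] by (force simp: r_def B_def)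
    qed
    have "r x = 0" by (simp add: r_def exp_rem_def)
    have up: "birth x * r (x + 1) \<le> birth x * exp_rem b"
    proof (cases "x = n")
      case False
      then show ?thesis using rates_nonneg[OF x] x nat_lipschitz_step[OF g, of x]
        by (intro mult_left_mono) (auto simp: r_def intro: exp_rem_mono)
    qed (simp add: birth_n)
    have down: "death x * r (x - 1) \<le> death x * exp_rem b"
    proof (cases "x = 0")
      case False
      then show ?thesis using rates_nonneg[OF x] x nat_lipschitz_step[OF g, of "x - 1"]
        by (intro mult_left_mono) (auto simp: r_def abs_minus_commute intro!: exp_rem_mono)
    qed (simp add: death_0)
    have "\<bar>semi h r x - h * (birth x * r (x + 1) + death x * r (x - 1))\<bar> \<le> \<epsilon> / B * h * B"
      using h x \<open>r x = 0\<close> rB by (rule h0(2))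
    then have "semi h r x \<le> h * (birth x * r (x + 1) + death x * r (x - 1)) + \<epsilon> * h"
      using B by simp
    also have "\<dots> \<le> h * ((birth x + death x) * exp_rem b) + \<epsilon> * h"
      using up down h by (intro add_right_mono mult_left_mono) (auto simp: algebra_simps)
    also have "\<dots> \<le> h * (rate_norm n birth death * exp_rem b) + \<epsilon> * h"
      using rates_le_rate_norm[OF x] h exp_rem_nonneg[of b]
      by (intro add_right_mono mult_left_mono mult_right_mono) auto
    finally have r_le: "semi h r x \<le> h * (rate_norm n birth death * exp_rem b + \<epsilon>)"
      by (simp add: algebra_simps)
    have "semi h (\<lambda>y. exp (g y)) x = exp (g x) * semi h (\<lambda>y. exp (g y - g x)) x"
      by (simp add: exp_diff flip: semi_cmult)
    also have "semi h (\<lambda>y. exp (g y - g x)) x = semi h r x + (\<Sum>y\<in>{0..n}. transition h x y * (1 + (g y - g x)))"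
      by (simp add: semi_def r_def exp_rem_def algebra_simps flip: sum.distrib)
    also have "(\<Sum>y\<in>{0..n}. transition h x y * (1 + (g y - g x))) = 1 + (semi h g x - g x)"
      using semi_increment[of x h g "g x"] sum_transition[of x h] x h
      by (simp add: distrib_left sum.distrib)
    also have "semi h r x + (1 + (semi h g x - g x))
        \<le> exp (h * (rate_norm n birth death * exp_rem b + \<epsilon>) + (semi h g x - g x))"
      using r_le exp_ge_add_one_self[of "h * (rate_norm n birth death * exp_rem b + \<epsilon>) + (semi h g x - g x)"]
      by linarith
    finally show "semi h (\<lambda>y. exp (g y)) x
        \<le> exp (semi h g x + h * (rate_norm n birth death * exp_rem b + \<epsilon>))"
      by (simp add: add_ac flip: exp_add)
  qed
qed

end

section \<open>Contraction of Lipschitz constants under the curvature condition\<close>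

locale contracting_birth_death = birth_death_process +
  fixes K :: real
  assumes K_pos: "0 < K"
    and curvature: "\<And>x. x \<in> {1..n} \<Longrightarrow> birth (x - 1) - birth x + death x - death (x - 1) \<ge> K"
begin

text \<open>To first order in \<open>h\<close>, the new increment over an edge is a combination of
  the old increments over that edge and its two neighbouring edges. For small \<open>h\<close> the
  weights are nonnegative, and the curvature condition bounds their sum by
  \<open>1 - h * K\<close>.\<close>

lemma contraction_step:
  assumes "0 < \<epsilon>"
  obtains h\<^sub>0 where "0 < h\<^sub>0"
    "\<And>h b g. 0 < h \<Longrightarrow> h < h\<^sub>0 \<Longrightarrow> nat_lipschitz b {0..n} g \<Longrightarrow>
       nat_lipschitz (b * exp (- (K - \<epsilon>) * h)) {0..n} (semi h g)"
proof -
  define R where "R = rate_norm n birth death"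
  have R0: "0 \<le> R" using rates_nonneg[of 0] rates_le_rate_norm[of 0] by (simp add: R_def)
  \<comment> \<open>An increment uses the approximation at two points, with total error
    \<open>2 * real n * \<delta>\<close> times \<open>h * b\<close>, which is at most
    \<open>\<epsilon> * h * b\<close>; the 1 in the denominator covers \<open>n = 0\<close>.\<close>
  define \<delta> where "\<delta> = \<epsilon> / (2 * real n + 1)"
  have \<delta>: "0 < \<delta>" using assms by (simp add: \<delta>_def)
  from semi_small_time[OF this] obtain h\<^sub>1 where h1: "0 < h\<^sub>1"
    "\<And>h x (g :: nat \<Rightarrow> real) C. 0 < h \<Longrightarrow> h < h\<^sub>1 \<Longrightarrow> x \<le> n \<Longrightarrow> g x = 0 \<Longrightarrow> (\<And>y. y \<le> n \<Longrightarrow> \<bar>g y\<bar> \<le> C) \<Longrightarrow>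
       \<bar>semi h g x - h * (birth x * g (x + 1) + death x * g (x - 1))\<bar> \<le> \<delta> * h * C"
    by metis
  \<comment> \<open>The second bound ensures \<open>h * s \<le> 1\<close> below, since
    \<open>s\<close> is a sum of two rates and hence at most \<open>2 * R\<close>.\<close>
  define h\<^sub>0 where "h\<^sub>0 = min h\<^sub>1 (1 / (2 * R + 1))"
  have "0 < h\<^sub>0" using h1(1) R0 by (simp add: h\<^sub>0_def)
  then show thesis
  proof (rule that)
    fix h b g
    assume h: "0 < h" "h < h\<^sub>0" and g: "nat_lipschitz b {0..n} g"
    have b0: "0 \<le> b" using nat_lipschitz_nonneg[OF g] .
    have approx: "\<bar>semi h g x - g x - h * bd_generator birth death g x\<bar> \<le> \<delta> * h * (real n * b)"
      if "x \<le> n" for x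
    proof -
      have "semi h g x - g x = semi h (\<lambda>y. g y - g x) x"
        using semi_increment[of x h g "g x"] that h by (simp add: semi_def)
      moreover have "\<bar>semi h (\<lambda>y. g y - g x) x
           - h * (birth x * (g (x + 1) - g x) + death x * (g (x - 1) - g x))\<bar> \<le> \<delta> * h * (real n * b)"
        using h that nat_lipschitz_diff[OF g that]
        by (intro h1(2)[of h x "\<lambda>y. g y - g x" "real n * b"]) (auto simp: h\<^sub>0_def)
      ultimately show ?thesis by (simp add: bd_generator_def)
    qed
    show "nat_lipschitz (b * exp (- (K - \<epsilon>) * h)) {0..n} (semi h g)"
    proof (rule nat_lipschitz_interval)
      fix x assume x: "x < n"
      define D where "D = g (Suc x) - g x"
      define U where "U = birth (Suc x) * (g (Suc (Suc x)) - g (Suc x))"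
      define V where "V = death x * (g x - g (x - 1))"
      define s where "s = birth x + death (Suc x)"
      have U: "\<bar>U\<bar> \<le> birth (Suc x) * b"
      proof (cases "Suc x = n")
        case False
        then show ?thesis
          using x rates_nonneg[of "Suc x"] nat_lipschitz_step[OF g, of "Suc x"]
          by (simp add: U_def abs_mult mult_left_mono)
      qed (simp add: U_def birth_n)
      have V: "\<bar>V\<bar> \<le> death x * b"
      proof (cases "x = 0")
        case False
        then show ?thesis
          using x rates_nonneg[of x] nat_lipschitz_step[OF g, of "x - 1"]
          by (simp add: V_def abs_mult mult_left_mono)
      qed (simp add: V_def death_0)
      have "s \<le> 2 * R" "0 \<le> s"
        using rates_le_rate_norm[of x] rates_le_rate_norm[of "Suc x"] rates_nonneg[of x]
          rates_nonneg[of "Suc x"] x by (auto simp: s_def R_def)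
      moreover have "h * (2 * R + 1) < 1" using h R0 by (simp add: h\<^sub>0_def field_simps)
      moreover have "h * s \<le> h * (2 * R)" using h(1) \<open>s \<le> 2 * R\<close> by (intro mult_left_mono) auto
      ultimately have hs: "0 \<le> 1 - h * s" using h(1) unfolding distrib_left by linarith
      have D: "\<bar>D\<bar> \<le> b" using nat_lipschitz_step[OF g x] by (simp add: D_def)
      have cur: "K \<le> s - birth (Suc x) - death x"
        using curvature[of "Suc x"] x by (simp add: s_def)
      \<comment> \<open>The generator changes the increment \<open>D\<close> at rate
        \<open>U + V - s * D\<close>: jumps across the edge itself give \<open>- s * D\<close>,
        outward jumps give \<open>U\<close> and \<open>V\<close>. At the ends of the interval
        \<open>U\<close> or \<open>V\<close> vanishes with its rate.\<close>
      have gen: "D + h * bd_generator birth death g (Suc x) - h * bd_generator birth death g x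
          = (1 - h * s) * D + h * U + h * V"
        by (simp add: bd_generator_def D_def U_def V_def s_def algebra_simps)
      have "\<bar>(1 - h * s) * D + h * U + h * V\<bar> \<le> (1 - h * s) * b + h * (birth (Suc x) * b) + h * (death x * b)"
      proof -
        have "\<bar>(1 - h * s) * D\<bar> \<le> (1 - h * s) * b"
          using D hs by (simp add: abs_mult mult_left_mono)
        moreover have "\<bar>h * U\<bar> \<le> h * (birth (Suc x) * b)" "\<bar>h * V\<bar> \<le> h * (death x * b)"
          using U V h by (auto simp: abs_mult mult_left_mono)
        ultimately show ?thesis by linarith
      qed
      also have "\<dots> = b * (1 - h * (s - birth (Suc x) - death x))" by (simp add: algebra_simps)
      also have "\<dots> \<le> b * (1 - h * K)"
        using cur h b0 by (intro mult_left_mono diff_left_mono) auto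
      finally have main: "\<bar>(1 - h * s) * D + h * U + h * V\<bar> \<le> b * (1 - h * K)" .
      have "\<bar>semi h g (Suc x) - semi h g x\<bar> \<le> b * (1 - h * K) + 2 * (\<delta> * h * (real n * b))"
        using approx[of "Suc x"] approx[of x] main gen x by (simp add: D_def)
      also have "\<dots> = b * (1 - h * K + h * (2 * real n * \<delta>))" by (simp add: algebra_simps)
      also have "\<dots> \<le> b * (1 - h * K + h * \<epsilon>)"
        using assms h b0 by (intro mult_left_mono add_left_mono) (auto simp: \<delta>_def field_simps)
      also have "\<dots> \<le> b * exp (- (K - \<epsilon>) * h)"
        using exp_ge_add_one_self[of "- (K - \<epsilon>) * h"] b0
        by (intro mult_left_mono) (auto simp: algebra_simps)
      finally show "\<bar>semi h g (Suc x) - semi h g x\<bar> \<le> b * exp (- (K - \<epsilon>) * h)" .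
    qed (use b0 in simp)
  qed
qed

lemma semi_0_lipschitz: "nat_lipschitz b {0..n} g \<Longrightarrow> nat_lipschitz b {0..n} (semi 0 g)"
  by (rule nat_lipschitz_cong) (auto simp: semi_0)

text \<open>The one-step contraction holds for every Lipschitz function with the same threshold, so
  \<open>m\<close> steps of length \<open>t / m\<close> multiply the rates to
  \<open>exp (- (K - \<epsilon>) * t)\<close>. This bound no longer involves \<open>m\<close>, and
  \<open>\<epsilon>\<close> can tend to 0.\<close>

lemma semi_lipschitz:
  assumes g: "nat_lipschitz b {0..n} g" and "0 \<le> t"
  shows "nat_lipschitz (b * exp (- K * t)) {0..n} (semi t g)"
proof (cases "t = 0")
  case True
  then show ?thesis using semi_0_lipschitz[OF g] by simp
next
  case False
  then have t: "0 < t" using assms by simp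
  have eps: "nat_lipschitz (b * exp (- (K - \<epsilon>) * t)) {0..n} (semi t g)" if "0 < \<epsilon>" for \<epsilon>
  proof -
    obtain h\<^sub>0 where h0: "0 < h\<^sub>0"
      "\<And>h b g. 0 < h \<Longrightarrow> h < h\<^sub>0 \<Longrightarrow> nat_lipschitz b {0..n} g \<Longrightarrow>
         nat_lipschitz (b * exp (- (K - \<epsilon>) * h)) {0..n} (semi h g)"
      using contraction_step[OF \<open>0 < \<epsilon>\<close>] by metis
    obtain m :: nat where m: "0 < t / real m" "t / real m < h\<^sub>0" "t = real m * (t / real m)"
      using nat_fraction_less[OF h0(1) t] by metis
    define h where "h = t / real m"
    have h: "0 < h" "h < h\<^sub>0" using m by (simp_all add: h_def)
    have "nat_lipschitz (b * exp (- (K - \<epsilon>) * (real k * h))) {0..n} (semi (real k * h) g)" for k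
    proof (induction k)
      case 0
      then show ?case using semi_0_lipschitz[OF g] by simp
    next
      case (Suc k)
      have lip: "nat_lipschitz (b * exp (- (K - \<epsilon>) * (real k * h)) * exp (- (K - \<epsilon>) * h)) {0..n}
          (semi h (semi (real k * h) g))"
        by (rule h0(2)[OF h Suc.IH])
      have rate: "b * exp (- (K - \<epsilon>) * (real (Suc k) * h))
          = b * exp (- (K - \<epsilon>) * (real k * h)) * exp (- (K - \<epsilon>) * h)"
        by (simp add: algebra_simps flip: exp_add)
      show ?case
        unfolding rate
      proof (rule nat_lipschitz_cong[OF lip])
        fix x assume "x \<in> {0..n}"
        then show "semi h (semi (real k * h) g) x = semi (real (Suc k) * h) g x"
          using semi_add[of x h "real k * h" g] h by (simp add: algebra_simps)
      qed
    qed
    from this[of m] show ?thesis using m(3) by (simp add: h_def)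
  qed
  show ?thesis
  proof (rule nat_lipschitzI)
    show "0 \<le> b * exp (- K * t)" using nat_lipschitz_nonneg[OF g] by simp
    fix x y assume xy: "x \<in> {0..n}" "y \<in> {0..n}"
    have "((\<lambda>\<epsilon>. b * exp (- (K - \<epsilon>) * t) * \<bar>real x - real y\<bar>) \<longlongrightarrow> b * exp (- (K - 0) * t) * \<bar>real x - real y\<bar>) (at_right 0)"
      by (intro tendsto_intros)
    moreover have "\<forall>\<^sub>F \<epsilon> in at_right 0. \<bar>semi t g x - semi t g y\<bar> \<le> b * exp (- (K - \<epsilon>) * t) * \<bar>real x - real y\<bar>"
      using eventually_at_right_less[of 0]
      by eventually_elim (use nat_lipschitzD[OF eps] xy in blast)
    ultimately have "\<bar>semi t g x - semi t g y\<bar> \<le> b * exp (- (K - 0) * t) * \<bar>real x - real y\<bar>"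
      by (rule tendsto_lowerbound) simp
    then show "\<bar>semi t g x - semi t g y\<bar> \<le> b * exp (- K * t) * \<bar>real x - real y\<bar>"
      by simp
  qed
qed

section \<open>The Laplace transform at a fixed time\<close>

text \<open>The induction hypothesis is inserted pointwise under one further \<open>semi h\<close>.
  The one-step bound then applies to \<open>u\<close>, whose Lipschitz constant has shrunk to
  \<open>a * q\<close>, so the new cost carries the factor \<open>q\<^sup>2\<close>.\<close>

lemma laplace_iterate:
  assumes h: "0 < h" and g: "nat_lipschitz a {0..n} g"
    and step: "\<And>b g x. b \<le> a \<Longrightarrow> nat_lipschitz b {0..n} g \<Longrightarrow> x \<le> n \<Longrightarrow>
       semi h (\<lambda>y. exp (g y)) x \<le> exp (semi h g x + h * (R * exp_rem b + \<epsilon>))"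
    and "0 \<le> R" "x \<le> n"
  shows "semi (real m * h) (\<lambda>y. exp (g y)) x
    \<le> exp (semi (real m * h) g x + h * (\<Sum>k<m. R * exp_rem a * exp (- 2 * K * h) ^ k + \<epsilon>))"
  using \<open>x \<le> n\<close>
proof (induction m arbitrary: x)
  case 0
  then show ?case by (simp add: semi_0)
next
  case (Suc m)
  define c where "c = h * (\<Sum>k<m. R * exp_rem a * exp (- 2 * K * h) ^ k + \<epsilon>)"
  define q where "q = exp (- K * (real m * h))"
  define u where "u = semi (real m * h) g"
  have a0: "0 \<le> a" using nat_lipschitz_nonneg[OF g] .
  have q: "0 \<le> q" "q \<le> 1" using h K_pos by (auto simp: q_def)
  have u: "nat_lipschitz (a * q) {0..n} u"
    using semi_lipschitz[OF g, of "real m * h"] h by (simp add: q_def u_def)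
  have split: "semi (real (Suc m) * h) v x = semi h (semi (real m * h) v) x" for v
    using semi_add[of x h "real m * h" v] Suc.prems h by (simp add: algebra_simps)
  have "semi (real (Suc m) * h) (\<lambda>y. exp (g y)) x \<le> semi h (\<lambda>y. exp c * exp (u y)) x"
    unfolding split using Suc.IH
    by (intro semi_mono) (simp add: c_def u_def add.commute flip: exp_add)
  also have "\<dots> = exp c * semi h (\<lambda>y. exp (u y)) x" by (rule semi_cmult)
  also have "\<dots> \<le> exp c * exp (semi h u x + h * (R * exp_rem (a * q) + \<epsilon>))"
    using step[OF _ u Suc.prems] a0 q by (intro mult_left_mono) (auto simp: mult_left_le)
  also have "\<dots> \<le> exp c * exp (semi h u x + h * (R * (q\<^sup>2 * exp_rem a) + \<epsilon>))"
    using exp_rem_le_scaled[of "a * q" q a] a0 q h \<open>0 \<le> R\<close>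
    by (intro mult_left_mono iffD2[OF exp_le_cancel_iff] add_left_mono add_right_mono)
       (auto simp: mult.commute)
  also have "\<dots> = exp (semi h u x + (c + h * (R * exp_rem a * q\<^sup>2 + \<epsilon>)))"
    by (simp add: mult_ac add_ac flip: exp_add)
  \<comment> \<open>The squared contraction factors form the geometric sequence of the
    claim.\<close>
  also have "q\<^sup>2 = exp (- 2 * K * h) ^ m"
    by (simp add: q_def power2_eq_square algebra_simps flip: exp_add exp_of_nat_mult)
  also have "c + h * (R * exp_rem a * exp (- 2 * K * h) ^ m + \<epsilon>)
      = h * (\<Sum>k<Suc m. R * exp_rem a * exp (- 2 * K * h) ^ k + \<epsilon>)"
    by (simp add: c_def algebra_simps)
  finally show ?case by (simp only: split u_def)
qed

text \<open>The geometric sum from the iteration is a Riemann sum of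
  \<open>exp (- 2 * K * s)\<close> over times \<open>s\<close> from 0 to \<open>t\<close>, whence
  the factor \<open>(1 - exp (- 2 * K * t)) / (2 * K)\<close>.\<close>

lemma laplace_bound:
  assumes g: "nat_lipschitz a {0..n} g" and t: "0 < t" and x: "x \<le> n"
  shows "semi t (\<lambda>y. exp (g y)) x
    \<le> exp (semi t g x + (1 - exp (- 2 * K * t)) * rate_norm n birth death / (2 * K) * exp_rem a)"
proof -
  define R where "R = rate_norm n birth death"
  define E where "E = R * exp_rem a"
  define r where "r = 1 - exp (- 2 * K * t)"
  have R0: "0 \<le> R" using rates_nonneg[of 0] rates_le_rate_norm[of 0] by (simp add: R_def)
  have E0: "0 \<le> E" using R0 exp_rem_nonneg by (simp add: E_def)
  have r0: "0 \<le> r" using K_pos t by (simp add: r_def)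
  have a0: "0 \<le> a" using nat_lipschitz_nonneg[OF g] .
  have eps: "semi t (\<lambda>y. exp (g y)) x \<le> exp (semi t g x + (r * (1 / (2 * K) + \<epsilon>) * E + t * \<epsilon>))"
    if "0 < \<epsilon>" for \<epsilon>
  proof -
    obtain h\<^sub>0 where h0: "0 < h\<^sub>0"
      "\<And>h b g x. 0 < h \<Longrightarrow> h < h\<^sub>0 \<Longrightarrow> b \<le> a \<Longrightarrow> nat_lipschitz b {0..n} g \<Longrightarrow> x \<le> n \<Longrightarrow>
         semi h (\<lambda>y. exp (g y)) x \<le> exp (semi h g x + h * (R * exp_rem b + \<epsilon>))"
      using laplace_step[OF \<open>0 < \<epsilon>\<close> a0] unfolding R_def by metis
    \<comment> \<open>Besides admitting the one-step bound, \<open>h\<close> must be below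
      \<open>\<epsilon>\<close> to absorb the discretisation error of the geometric sum.\<close>
    have "0 < min h\<^sub>0 \<epsilon>" using h0(1) that by simp
    then obtain m :: nat where m: "0 < t / real m" "t / real m < min h\<^sub>0 \<epsilon>" "t = real m * (t / real m)"
      using nat_fraction_less[OF _ t] by metis
    define h where "h = t / real m"
    have h: "0 < h" "h < h\<^sub>0" "h < \<epsilon>" and mh: "t = real m * h" using m by (simp_all add: h_def)
    define p where "p = exp (- 2 * K * h)"
    have p: "p < 1" using h K_pos by (simp add: p_def)
    \<comment> \<open>This gives \<open>p \<le> 1 / (1 + 2 * K * h)\<close>, which rearranges to
      \<open>h / (1 - p) \<le> 1 / (2 * K) + h\<close>.\<close>
    have "1 + 2 * K * h \<le> exp (2 * K * h)" by (rule exp_ge_add_one_self)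
    then have "p * (1 + 2 * K * h) \<le> p * exp (2 * K * h)"
      by (intro mult_left_mono) (auto simp: p_def)
    then have "p * (1 + 2 * K * h) \<le> 1"
      by (simp add: p_def flip: exp_add)
    then have hp: "h \<le> (1 - p) * (1 / (2 * K) + h)"
      using h K_pos by (simp add: field_simps)
    have pm: "p ^ m = exp (- 2 * K * t)"
      unfolding mh p_def by (simp add: algebra_simps flip: exp_of_nat_mult)
    have "h * (\<Sum>k<m. p ^ k) = r * (h / (1 - p))"
      using p by (simp add: geometric_sum r_def pm field_simps)
    also have "\<dots> \<le> r * (1 / (2 * K) + \<epsilon>)"
    proof (intro mult_left_mono r0)
      have "h / (1 - p) \<le> 1 / (2 * K) + h" using hp p by (simp add: field_simps)
      then show "h / (1 - p) \<le> 1 / (2 * K) + \<epsilon>" using h by linarith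
    qed
    finally have geo: "h * (\<Sum>k<m. p ^ k) \<le> r * (1 / (2 * K) + \<epsilon>)" .
    have "semi t (\<lambda>y. exp (g y)) x \<le> exp (semi t g x + h * (\<Sum>k<m. R * exp_rem a * p ^ k + \<epsilon>))"
      unfolding mh p_def using h0(2) h R0 x by (intro laplace_iterate[OF h(1) g]) auto
    also have "h * (\<Sum>k<m. R * exp_rem a * p ^ k + \<epsilon>) = h * (\<Sum>k<m. p ^ k) * E + t * \<epsilon>"
      unfolding mh by (simp add: E_def sum.distrib algebra_simps flip: sum_distrib_left)
    also have "exp (semi t g x + (h * (\<Sum>k<m. p ^ k) * E + t * \<epsilon>))
        \<le> exp (semi t g x + (r * (1 / (2 * K) + \<epsilon>) * E + t * \<epsilon>))"
      using geo E0 by (simp add: mult_right_mono)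
    finally show ?thesis .
  qed
  have "((\<lambda>\<epsilon>. exp (semi t g x + (r * (1 / (2 * K) + \<epsilon>) * E + t * \<epsilon>)))
      \<longlongrightarrow> exp (semi t g x + (r * (1 / (2 * K) + 0) * E + t * 0))) (at_right 0)"
    by (intro tendsto_intros)
  moreover have "\<forall>\<^sub>F \<epsilon> in at_right 0.
      semi t (\<lambda>y. exp (g y)) x \<le> exp (semi t g x + (r * (1 / (2 * K) + \<epsilon>) * E + t * \<epsilon>))"
    using eventually_at_right_less[of 0] by eventually_elim (rule eps)
  ultimately have "semi t (\<lambda>y. exp (g y)) x \<le> exp (semi t g x + (r * (1 / (2 * K) + 0) * E + t * 0))"
    by (rule tendsto_lowerbound) simp
  then show ?thesis by (simp add: r_def E_def R_def mult.assoc)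
qed

section \<open>The Laplace transform under the stationary distribution\<close>

lemma stationary_semi:
  assumes "stationary_distribution {0..n} P X \<pi>" "0 \<le> t"
  shows "(\<Sum>x\<in>{0..n}. pmf \<pi> x * semi t g x) = (\<Sum>x\<in>{0..n}. pmf \<pi> x * g x)"
proof -
  have "(\<Sum>x\<in>{0..n}. pmf \<pi> x * semi t g x)
      = (\<Sum>x\<in>{0..n}. \<Sum>y\<in>{0..n}. pmf \<pi> x * transition t x y * g y)"
    by (simp add: semi_def sum_distrib_left mult_ac)
  also have "\<dots> = (\<Sum>y\<in>{0..n}. \<Sum>x\<in>{0..n}. pmf \<pi> x * transition t x y * g y)"
    by (rule sum.swap)
  also have "\<dots> = (\<Sum>y\<in>{0..n}. pmf \<pi> y * g y)"
    using assms by (intro sum.cong) (auto simp: stationary_distribution_def transition_def simp flip: sum_distrib_right)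
  finally show ?thesis .
qed

lemma sum_stationary:
  assumes "stationary_distribution {0..n} P X \<pi>"
  shows "(\<Sum>x\<in>{0..n}. pmf \<pi> x) = 1"
  using assms sum_pmf_eq_1[of "{0..n}" \<pi>] by (simp add: stationary_distribution_def)

text \<open>Averaging the time-\<open>t\<close> bound over the stationary law leaves the left side
  unchanged. Contraction puts \<open>semi t g x\<close> within
  \<open>real n * (a * exp (- K * t))\<close> of the stationary mean, an error that disappears as
  \<open>t\<close> grows.\<close>

lemma stationary_laplace_bound:
  assumes \<pi>: "stationary_distribution {0..n} P X \<pi>" and g: "nat_lipschitz a {0..n} g"
  shows "(\<Sum>x\<in>{0..n}. pmf \<pi> x * exp (g x))
    \<le> exp ((\<Sum>x\<in>{0..n}. pmf \<pi> x * g x) + rate_norm n birth death / (2 * K) * exp_rem a)"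
    (is "?l \<le> exp (?m + ?C * _)")
proof -
  have C: "0 \<le> ?C" using rates_nonneg[of 0] rates_le_rate_norm[of 0] K_pos by simp
  define F where "F t = exp (?m + real n * (a * exp (- K * t)) + ?C * exp_rem a)" for t
  have fin: "?l \<le> F t" if t: "0 < t" for t
  proof -
    have lip: "nat_lipschitz (a * exp (- K * t)) {0..n} (semi t g)"
      using semi_lipschitz[OF g] t by simp
    have "?l = (\<Sum>x\<in>{0..n}. pmf \<pi> x * semi t (\<lambda>y. exp (g y)) x)"
      using stationary_semi[OF \<pi>, of t "\<lambda>y. exp (g y)"] t by simp
    also have "\<dots> \<le> (\<Sum>x\<in>{0..n}. pmf \<pi> x * F t)"
    proof (intro sum_mono mult_left_mono)
      fix x assume x: "x \<in> {0..n}"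
      \<comment> \<open>By invariance \<open>?m\<close> is also the stationary mean of
        \<open>semi t g\<close>, so the gap is an average of differences of a single Lipschitz
        function.\<close>
      have "semi t g x - ?m = (\<Sum>z\<in>{0..n}. pmf \<pi> z * (semi t g x - semi t g z))"
        using sum_stationary[OF \<pi>] stationary_semi[OF \<pi>, of t g] t
        by (simp add: right_diff_distrib sum_subtractf flip: sum_distrib_right)
      also have "\<dots> \<le> (\<Sum>z\<in>{0..n}. pmf \<pi> z * (real n * (a * exp (- K * t))))"
        using nat_lipschitz_diff[OF lip] x
        by (intro sum_mono mult_left_mono) (auto intro: order_trans[OF abs_ge_self])
      also have "\<dots> = real n * (a * exp (- K * t))"
        using sum_stationary[OF \<pi>] by (simp flip: sum_distrib_right)
      finally have mean: "semi t g x \<le> ?m + real n * (a * exp (- K * t))" by simp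
      have "(1 - exp (- 2 * K * t)) * ?C * exp_rem a \<le> 1 * ?C * exp_rem a"
        using C exp_rem_nonneg[of a] by (intro mult_right_mono) auto
      then have "semi t g x + (1 - exp (- 2 * K * t)) * rate_norm n birth death / (2 * K) * exp_rem a
          \<le> ?m + real n * (a * exp (- K * t)) + ?C * exp_rem a"
        using mean by simp
      then show "semi t (\<lambda>y. exp (g y)) x \<le> F t"
        using order_trans[OF laplace_bound[OF g t, of x]] x by (simp add: F_def)
    qed simp
    also have "\<dots> = F t"
      using sum_stationary[OF \<pi>] by (simp flip: sum_distrib_right)
    finally show ?thesis .
  qed
  have "((\<lambda>t. exp (- K * t)) \<longlongrightarrow> 0) at_top"
    using K_pos by (intro filterlim_compose[OF exp_at_bot] filterlim_tendsto_neg_mult_at_bot[OF tendsto_const _ filterlim_ident]) auto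
  then have "(F \<longlongrightarrow> exp (?m + real n * (a * 0) + ?C * exp_rem a)) at_top"
    unfolding F_def by (intro tendsto_intros)
  moreover have "\<forall>\<^sub>F t in at_top. ?l \<le> F t"
    using eventually_gt_at_top[of 0] by eventually_elim (rule fin)
  ultimately have "?l \<le> exp (?m + real n * (a * 0) + ?C * exp_rem a)"
    by (rule tendsto_lowerbound) simp
  then show ?thesis by simp
qed

end

section \<open>Tail bounds at a fixed time and under the stationary distribution\<close>

text \<open>When \<open>lip_norm\<close> is 0 the exponent would divide by zero, so the bound is
  read as its limit 0. This is correct because \<open>f\<close> is then constant on the states and
  cannot exceed its mean by \<open>y > 0\<close>.\<close>

theorem corollary4p9:
  fixes n :: nat
    and birth death :: "nat \<Rightarrow> real"
    and P :: "nat \<Rightarrow> 'w measure"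
    and X :: "real \<Rightarrow> 'w \<Rightarrow> nat"
    and \<pi> :: "nat pmf"
    and K :: real
    and f :: "nat \<Rightarrow> real"
  assumes "birth_death_process n birth death P X"
    and "stationary_distribution {0..n} P X \<pi>"
    and "K > 0"
    and "\<And>x. x \<in> {1..n} \<Longrightarrow> birth (x - 1) - birth x + death x - death (x - 1) \<ge> K"
    and "f \<in> Lip {0..n}"
  shows "(\<forall>x\<in>{0..n}. \<forall>t>0. \<forall>y>0.
            \<P>(\<omega> in P x. f (X t \<omega>) - (\<integral>\<omega>. f (X t \<omega>) \<partial>P x) \<ge> y)
              \<le> (if lip_norm {0..n} f = 0 then 0 else
                  exp (- (y / (2 * lip_norm {0..n} f)) *
                    ln (1 + 2 * K * y /
                      ((1 - exp (- 2 * K * t)) * rate_norm n birth death * lip_norm {0..n} f))))) \<and>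
         (\<forall>y>0.
            measure_pmf.prob \<pi> {z \<in> {0..n}. f z - (\<Sum>x\<in>{0..n}. f x * pmf \<pi> x) \<ge> y}
              \<le> (if lip_norm {0..n} f = 0 then 0 else
                  exp (- (y / (2 * lip_norm {0..n} f)) *
                    ln (1 + 2 * K * y / (rate_norm n birth death * lip_norm {0..n} f)))))"
proof -
  interpret birth_death_process n birth death P X by fact
  interpret contracting_birth_death n birth death P X K
    by unfold_locales (use assms in auto)
  note \<pi> = assms(2)
  define M where "M = lip_norm {0..n} f"
  have lip: "nat_lipschitz M {0..n} f"
    using nat_lipschitz_lip_norm[OF assms(5)] by (simp add: M_def)
  have M0: "0 \<le> M" using nat_lipschitz_nonneg[OF lip] .
  define c where "c = f 0"
  have const: "f z = c" if "M = 0" "z \<le> n" for z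
    using nat_lipschitz_diff[OF lip, of 0 z] that by (simp add: c_def)
  \<comment> \<open>Chernoff's bound needs a positive \<open>C\<close>. A nonzero \<open>M\<close>
    rules out the one-point space, where only the inserted 0 enters the supremum, and then
    \<open>birth 0\<close> is positive.\<close>
  have R: "0 < rate_norm n birth death" if "M \<noteq> 0"
  proof -
    have "n \<noteq> 0"
    proof
      assume "n = 0"
      then have "lip_quotients {0..n} f = {}" by (auto simp: lip_quotients_def)
      then show False using that by (simp add: M_def lip_norm_def)
    qed
    then show ?thesis
      using birth_pos[of 0] death_0 rates_le_rate_norm[of 0] by simp
  qed
  have scaled: "nat_lipschitz (a * M) {0..n} (\<lambda>z. a * f z)" if "0 < a" for a
    using nat_lipschitz_cmult[OF lip, of a] that by simp
  have "\<P>(\<omega> in P x. f (X t \<omega>) - (\<integral>\<omega>. f (X t \<omega>) \<partial>P x) \<ge> y)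
      \<le> (if M = 0 then 0 else exp (- (y / (2 * M)) *
            ln (1 + 2 * K * y / ((1 - exp (- 2 * K * t)) * rate_norm n birth death * M))))"
    if x: "x \<in> {0..n}" and t: "0 < t" and y: "0 < y" for x t y
  proof -
    have prob: "\<P>(\<omega> in P x. f (X t \<omega>) - (\<integral>\<omega>. f (X t \<omega>) \<partial>P x) \<ge> y)
        = (\<Sum>z\<in>{z\<in>{0..n}. f z - semi t f x \<ge> y}. transition t x z)"
      unfolding integral_eq_semi[of x t f, OF x less_imp_le[OF t]]
      by (rule prob_eq_sum_transition[of x t "\<lambda>z. f z - semi t f x \<ge> y", OF x less_imp_le[OF t]])
    show ?thesis
    proof (cases "M = 0")
      case True
      have "semi t f x = semi t (\<lambda>_. c) x"
        unfolding semi_def using const[OF True] by (intro sum.cong) auto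
      also have "\<dots> = c" using x t by (intro semi_const) auto
      finally have "{z\<in>{0..n}. f z - semi t f x \<ge> y} = {}" using const[OF True] y by auto
      then have "(\<Sum>z\<in>{z\<in>{0..n}. f z - semi t f x \<ge> y}. transition t x z) = 0"
        by (simp only: sum.empty)
      then show ?thesis using prob True by simp
    next
      case False
      \<comment> \<open>The coefficient of \<open>exp_rem\<close> in \<open>laplace_bound\<close>;
        with it \<open>y / (C * M)\<close> is the fraction inside the logarithm.\<close>
      define C where "C = (1 - exp (- 2 * K * t)) * rate_norm n birth death / (2 * K)"
      have C: "0 < C" using R[OF False] t \<open>K > 0\<close> by (simp add: C_def)
      have "(\<Sum>z\<in>{z\<in>{0..n}. f z - semi t f x \<ge> y}. transition t x z)
          \<le> exp (- (y / (2 * M)) * ln (1 + y / (C * M)))"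
      proof (rule chernoff_exp_rem)
        fix a :: real assume "0 < a"
        then show "(\<Sum>z\<in>{0..n}. transition t x z * exp (a * f z)) \<le> exp (a * semi t f x + C * exp_rem (a * M))"
          using laplace_bound[OF scaled t, of a x] x by (simp add: semi_cmult C_def) (simp add: semi_def)
      qed (use C M0 False y in \<open>auto simp: transition_nonneg\<close>)
      moreover have "y / (C * M) = 2 * K * y / ((1 - exp (- 2 * K * t)) * rate_norm n birth death * M)"
        by (simp add: C_def)
      ultimately show ?thesis using prob False by simp
    qed
  qed
  moreover have "measure_pmf.prob \<pi> {z \<in> {0..n}. f z - (\<Sum>x\<in>{0..n}. f x * pmf \<pi> x) \<ge> y}
      \<le> (if M = 0 then 0 else exp (- (y / (2 * M)) * ln (1 + 2 * K * y / (rate_norm n birth death * M))))"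
    if y: "0 < y" for y
  proof -
    define m where "m = (\<Sum>x\<in>{0..n}. f x * pmf \<pi> x)"
    have prob: "measure_pmf.prob \<pi> {z \<in> {0..n}. f z - m \<ge> y} = (\<Sum>z\<in>{z\<in>{0..n}. f z - m \<ge> y}. pmf \<pi> z)"
      by (intro measure_measure_pmf_finite) auto
    show ?thesis
    proof (cases "M = 0")
      case True
      have "m = (\<Sum>x\<in>{0..n}. c * pmf \<pi> x)"
        unfolding m_def using const[OF True] by (intro sum.cong) auto
      also have "\<dots> = c" using sum_stationary[OF \<pi>] by (simp flip: sum_distrib_left)
      finally have "{z\<in>{0..n}. f z - m \<ge> y} = {}" using const[OF True] y by auto
      then show ?thesis using True by (simp add: m_def del: Collect_empty_eq)
    next
      case False
      \<comment> \<open>The limit of the previous coefficient as \<open>t\<close> tends to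
        infinity.\<close>
      define C where "C = rate_norm n birth death / (2 * K)"
      have C: "0 < C" using R[OF False] \<open>K > 0\<close> by (simp add: C_def)
      have "(\<Sum>z\<in>{z\<in>{0..n}. f z - m \<ge> y}. pmf \<pi> z)
          \<le> exp (- (y / (2 * M)) * ln (1 + y / (C * M)))"
      proof (rule chernoff_exp_rem)
        fix a :: real assume "0 < a"
        moreover have "(\<Sum>z\<in>{0..n}. pmf \<pi> z * (a * f z)) = a * m"
          by (simp add: m_def sum_distrib_left mult_ac)
        ultimately show "(\<Sum>z\<in>{0..n}. pmf \<pi> z * exp (a * f z)) \<le> exp (a * m + C * exp_rem (a * M))"
          using stationary_laplace_bound[OF \<pi> scaled, of a] by (simp add: C_def)
      qed (use C M0 False y in auto)
      moreover have "y / (C * M) = 2 * K * y / (rate_norm n birth death * M)"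
        by (simp add: C_def)
      ultimately show ?thesis using prob False by (simp add: m_def)
    qed
  qed
  ultimately show ?thesis unfolding M_def by blast
qed

end
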